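(* Let $a,b,p,q$ be real numbers, let $(w_n)_{n\ge 0}$ be the Horadam sequence $w_0=a$, $w_1=b$, $w_n=pw_{n-1}+qw_{n-2}$ for $n\ge 2$, and let $\widehat{\mathbb{O}G_n}=\mathbb{O}G_n+\mathbb{O}G_{n+1}\epsilon$ be the $n$-th dual Horadam octonion. Let $\alpha=\frac{p+\sqrt{p^2+4q}}{2}$, $\beta=\frac{p-\sqrt{p^2+4q}}{2}$, and assume $\alpha\ne\beta$, $\alpha\neq 1$, $\beta\ne 1$. Let $A=b-a\beta$, $B=b-a\alpha$, $\underline{\alpha}=e_0+\alpha e_1+\dots+\alpha^7e_7$ and $\underline{\beta}=e_0+\beta e_1+\dots+\beta^7e_7$. Then for all $n\ge 0$, $$\sum_{i=0}^n\widehat{\mathbb{O}G_{i}}=\sum_{i=0}^n\mathbb{O}G_i+\sum_{i=1}^{n+1}\mathbb{O}G_i\,\epsilon=(d_1,d_2),$$ where $$d_1=\sum_{i=0}^n\mathbb{O}G_i=\frac{1}{\alpha-\beta}\left(\frac{B\underline{\beta}\beta^{n+1}}{1-\beta}-\frac{A\underline{\alpha}\alpha^{n+1}}{1-\alpha}\right)+K,$$ $$d_2=\sum_{i=1}^{n+1}\mathbb{O}G_i=\frac{1}{\alpha-\beta}\left(\frac{B\underline{\beta}\beta^{n+2}}{1-\beta}-\frac{A\underline{\alpha}\alpha^{n+2}}{1-\alpha}\right)-\mathbb{O}G_0+K,$$ and $$K=\frac{A\underline{\alpha}(1-\beta)-B\underline{\beta}(1-\alpha)}{(\alpha-\beta)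(1-\alpha)(1-\beta)}.$$
   Context: Let $\mathbb{O}$ be the real octonions with basis $e_0,\dots,e_7$, where $e_0=1$ is the identity. The $n$-th Horadam octonion is $\mathbb{O}G_n=w_ne_0+w_{n+1}e_1+\dots+w_{n+7}e_7$. A dual octonion is $\widehat K=(k,l)=k+l\epsilon$ with $k,l\in\mathbb{O}$, where $\epsilon\ne 0$, $\epsilon^2=0$; addition is componentwise. The dual Horadam octonion is $\widehat{\mathbb{O}G_n}=(\mathbb{O}G_n,\mathbb{O}G_{n+1})=\mathbb{O}G_n+\mathbb{O}G_{n+1}\epsilon$. If $p^2+4q<0$, then $\alpha,\beta$ are complex and the identities are read in the complexification of the dual octonions. *)

theory Defs
  imports Complex_Main
begin

fun horadam :: "real \<Rightarrow> real \<Rightarrow> real \<Rightarrow> real \<Rightarrow> nat \<Rightarrow> real" where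
  "horadam a b p q 0 = a"
| "horadam a b p q (Suc 0) = b"
| "horadam a b p q (Suc (Suc n)) = p * horadam a b p q (Suc n) + q * horadam a b p q n"

text \<open>
  The octonion algebra is defined over an arbitrary coefficient ring, so that
  \<^typ>\<open>real\<close> coefficients give the real octonions and \<^typ>\<open>complex\<close> coefficients
  give their complexification.
\<close>

datatype 'a octonion =
  Octonion (oc0: 'a) (oc1: 'a) (oc2: 'a) (oc3: 'a) (oc4: 'a) (oc5: 'a) (oc6: 'a) (oc7: 'a)

instantiation octonion :: (ab_group_add) ab_group_add
begin

definition zero_octonion where "0 = Octonion 0 0 0 0 0 0 0 0"

definition plus_octonion where
  "x + y = Octonion (oc0 x + oc0 y) (oc1 x + oc1 y) (oc2 x + oc2 y) (oc3 x + oc3 y)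
                    (oc4 x + oc4 y) (oc5 x + oc5 y) (oc6 x + oc6 y) (oc7 x + oc7 y)"

definition uminus_octonion where
  "- x = Octonion (- oc0 x) (- oc1 x) (- oc2 x) (- oc3 x) (- oc4 x) (- oc5 x) (- oc6 x) (- oc7 x)"

definition minus_octonion where
  "x - y = Octonion (oc0 x - oc0 y) (oc1 x - oc1 y) (oc2 x - oc2 y) (oc3 x - oc3 y)
                    (oc4 x - oc4 y) (oc5 x - oc5 y) (oc6 x - oc6 y) (oc7 x - oc7 y)"

instance
  by standard
     (simp_all add: zero_octonion_def plus_octonion_def uminus_octonion_def minus_octonion_def
        ac_simps)

end

text \<open>
  The product is the Cayley--Dickson one: \<open>e\<^sub>i e\<^sub>i = -1\<close> for \<open>i \<noteq> 0\<close>, and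
  \<open>e\<^sub>i e\<^sub>j = e\<^sub>k = - e\<^sub>j e\<^sub>i\<close> for \<open>(i,j,k)\<close> a cyclic permutation of
  123, 145, 176, 246, 257, 347 or 365.
\<close>

instantiation octonion :: (comm_ring_1) "{one, times}"
begin

definition one_octonion where "1 = Octonion 1 0 0 0 0 0 0 0"

definition times_octonion where
  "x * y = Octonion
    (oc0 x * oc0 y - oc1 x * oc1 y - oc2 x * oc2 y - oc3 x * oc3 y
      - oc4 x * oc4 y - oc5 x * oc5 y - oc6 x * oc6 y - oc7 x * oc7 y)
    (oc0 x * oc1 y + oc1 x * oc0 y + oc2 x * oc3 y - oc3 x * oc2 y
      + oc4 x * oc5 y - oc5 x * oc4 y - oc6 x * oc7 y + oc7 x * oc6 y)
    (oc0 x * oc2 y - oc1 x * oc3 y + oc2 x * oc0 y + oc3 x * oc1 y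
      + oc4 x * oc6 y + oc5 x * oc7 y - oc6 x * oc4 y - oc7 x * oc5 y)
    (oc0 x * oc3 y + oc1 x * oc2 y - oc2 x * oc1 y + oc3 x * oc0 y
      + oc4 x * oc7 y - oc5 x * oc6 y + oc6 x * oc5 y - oc7 x * oc4 y)
    (oc0 x * oc4 y - oc1 x * oc5 y - oc2 x * oc6 y - oc3 x * oc7 y
      + oc4 x * oc0 y + oc5 x * oc1 y + oc6 x * oc2 y + oc7 x * oc3 y)
    (oc0 x * oc5 y + oc1 x * oc4 y - oc2 x * oc7 y + oc3 x * oc6 y
      - oc4 x * oc1 y + oc5 x * oc0 y - oc6 x * oc3 y + oc7 x * oc2 y)
    (oc0 x * oc6 y + oc1 x * oc7 y + oc2 x * oc4 y - oc3 x * oc5 y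
      - oc4 x * oc2 y + oc5 x * oc3 y + oc6 x * oc0 y - oc7 x * oc1 y)
    (oc0 x * oc7 y - oc1 x * oc6 y + oc2 x * oc5 y + oc3 x * oc4 y
      - oc4 x * oc3 y - oc5 x * oc2 y + oc6 x * oc1 y + oc7 x * oc0 y)"

instance ..

end

lemma octonion_one_mult [simp]:
  fixes x :: "'a::comm_ring_1 octonion"
  shows "1 * x = x" "x * 1 = x"
  by (simp_all add: one_octonion_def times_octonion_def)

lemma octonion_zero_mult [simp]:
  fixes x :: "'a::comm_ring_1 octonion"
  shows "0 * x = 0" "x * 0 = 0"
  by (simp_all add: zero_octonion_def times_octonion_def)

lemma octonion_alternative:
  fixes x y :: "'a::comm_ring_1 octonion"
  shows "x * (x * y) = (x * x) * y" "(y * x) * x = y * (x * x)"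
  by (simp_all add: times_octonion_def algebra_simps)

definition oct_scale :: "'a::comm_ring_1 \<Rightarrow> 'a octonion \<Rightarrow> 'a octonion"  (infixr "*\<^sub>O" 75) where
  "c *\<^sub>O x = map_octonion ((*) c) x"

definition oct_basis :: "nat \<Rightarrow> 'a::comm_ring_1 octonion" where
  "oct_basis k = Octonion (of_bool (k = 0)) (of_bool (k = 1)) (of_bool (k = 2)) (of_bool (k = 3))
                          (of_bool (k = 4)) (of_bool (k = 5)) (of_bool (k = 6)) (of_bool (k = 7))"

lemma oct_basis_0: "oct_basis 0 = 1"
  by (simp add: oct_basis_def one_octonion_def)

definition complexify :: "real octonion \<Rightarrow> complex octonion" where
  "complexify = map_octonion complex_of_real"

text \<open>
  Since \<^const>\<open>complexify\<close> is injective and compatible with the operations, an identity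
  between complexified octonions with real scalars is the same as the real identity.
\<close>

lemma inj_complexify: "inj complexify"
  unfolding complexify_def by (intro octonion.inj_map inj_of_real)

lemma complexify_hom:
  "complexify (x + y) = complexify x + complexify y"
  "complexify (x - y) = complexify x - complexify y"
  "complexify (x * y) = complexify x * complexify y"
  "complexify (c *\<^sub>O x) = complex_of_real c *\<^sub>O complexify x"
  "complexify (oct_basis k) = oct_basis k"
  by (cases x; cases y;
      simp add: complexify_def plus_octonion_def minus_octonion_def times_octonion_def
        oct_scale_def oct_basis_def)+

definition power_octonion :: "'a::comm_ring_1 \<Rightarrow> 'a octonion" where
  "power_octonion z = (\<Sum>k = 0..7. z ^ k *\<^sub>O oct_basis k)"

text \<open>\<open>Dual k l\<close> is the dual octonion \<open>k + l\<epsilon>\<close>.\<close>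

datatype 'a dual_octonion = Dual (oct_re: "'a octonion") (oct_du: "'a octonion")

instantiation dual_octonion :: (ab_group_add) ab_group_add
begin

definition zero_dual_octonion where "0 = Dual 0 0"

definition plus_dual_octonion where
  "x + y = Dual (oct_re x + oct_re y) (oct_du x + oct_du y)"

definition uminus_dual_octonion where "- x = Dual (- oct_re x) (- oct_du x)"

definition minus_dual_octonion where
  "x - y = Dual (oct_re x - oct_re y) (oct_du x - oct_du y)"

instance
  by standard
     (simp_all add: zero_dual_octonion_def plus_dual_octonion_def uminus_dual_octonion_def
        minus_dual_octonion_def ac_simps)

end

instantiation dual_octonion :: (comm_ring_1) "{one, times}"
begin

definition one_dual_octonion where "1 = Dual 1 0"

definition times_dual_octonion where
  "x * y = Dual (oct_re x * oct_re y) (oct_re x * oct_du y + oct_du x * oct_re y)"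

instance ..

end

definition dual_of_oct :: "'a::comm_ring_1 octonion \<Rightarrow> 'a dual_octonion" where
  "dual_of_oct k = Dual k 0"

definition dual_eps :: "'a::comm_ring_1 dual_octonion"  ("\<epsilon>") where
  "\<epsilon> = Dual 0 1"

lemma dual_eps_square: "\<epsilon> * \<epsilon> = (0 :: 'a::comm_ring_1 dual_octonion)"
  by (simp add: dual_eps_def times_dual_octonion_def zero_dual_octonion_def)

lemma dual_eps_nonzero: "(\<epsilon> :: 'a::comm_ring_1 dual_octonion) \<noteq> 0"
  by (simp add: dual_eps_def zero_dual_octonion_def one_octonion_def zero_octonion_def)

lemma Dual_eq: "Dual k l = dual_of_oct k + dual_of_oct l * \<epsilon>"
  by (simp add: dual_of_oct_def dual_eps_def plus_dual_octonion_def times_dual_octonion_def)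

definition horadam_oct :: "real \<Rightarrow> real \<Rightarrow> real \<Rightarrow> real \<Rightarrow> nat \<Rightarrow> real octonion" where
  "horadam_oct a b p q n = (\<Sum>k = 0..7. horadam a b p q (n + k) *\<^sub>O oct_basis k)"

definition dual_horadam_oct :: "real \<Rightarrow> real \<Rightarrow> real \<Rightarrow> real \<Rightarrow> nat \<Rightarrow> real dual_octonion" where
  "dual_horadam_oct a b p q n = Dual (horadam_oct a b p q n) (horadam_oct a b p q (n + 1))"

end

theory Submission
  imports Defs
begin

text \<open>
  Binet's formula writes the \<open>i\<close>-th Horadam octonion as a combination of the two fixed octonions
  \<^term>\<open>power_octonion \<alpha>\<close> and \<^term>\<open>power_octonion \<beta>\<close> with coefficients
  \<open>A \<alpha>\<^sup>i / (\<alpha> - \<beta>)\<close> and \<open>- B \<beta>\<^sup>i / (\<alpha> - \<beta>)\<close>, so summing over \<open>i \<le> n\<close> leaves two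
  geometric series. The dual component is the same sum for \<open>n + 1\<close> without its term \<open>i = 0\<close>.
\<close>

text \<open>Scaling acts coordinatewise, so the module laws are those of the ring. They give the
  distribution of scalars over finite sums and differences used below.\<close>

interpretation octonion: module "oct_scale :: 'a::comm_ring_1 \<Rightarrow> 'a octonion \<Rightarrow> 'a octonion"
  by standard
     (auto simp: oct_scale_def plus_octonion_def octonion.map_sel octonion.map_comp o_def
        octonion.expand algebra_simps intro!: octonion.expand)

lemma complexify_zero: "complexify 0 = 0"
  by (simp add: complexify_def zero_octonion_def)

lemma complexify_sum: "complexify (sum f I) = (\<Sum>i\<in>I. complexify (f i))"
  by (induction I rule: infinite_finite_induct) (simp_all add: complexify_zero complexify_hom(1))

lemma Dual_sum: "(\<Sum>i\<in>I. Dual (f i) (g i)) = Dual (sum f I) (sum g I)"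
  by (induction I rule: infinite_finite_induct)
     (simp_all add: zero_dual_octonion_def plus_dual_octonion_def)

text \<open>Both sides satisfy the Horadam recurrence and agree at 0 and 1. The factor
  \<open>\<alpha> - \<beta>\<close> on the left keeps the induction free of division.\<close>

lemma horadam_binet:
  fixes \<alpha> \<beta> :: complex
  assumes "\<alpha>\<^sup>2 = of_real p * \<alpha> + of_real q" and "\<beta>\<^sup>2 = of_real p * \<beta> + of_real q"
  shows "(\<alpha> - \<beta>) * of_real (horadam a b p q n) =
           (of_real b - of_real a * \<beta>) * \<alpha> ^ n - (of_real b - of_real a * \<alpha>) * \<beta> ^ n"
proof (induction n rule: induct_nat_012)
  case (ge2 n)
  have "(\<alpha> - \<beta>) * of_real (horadam a b p q (Suc (Suc n))) =
      of_real p * ((\<alpha> - \<beta>) * of_real (horadam a b p q (Suc n))) +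
      of_real q * ((\<alpha> - \<beta>) * of_real (horadam a b p q n))"
    by (simp add: algebra_simps)
  \<comment> \<open>The grouping isolates \<open>p * \<alpha> + q\<close> and
    \<open>p * \<beta> + q\<close>, which the root equations turn into squares, raising the exponent
    from \<open>n\<close> to \<open>n + 2\<close>.\<close>
  also have "\<dots> =
      (of_real b - of_real a * \<beta>) * (\<alpha> ^ n * (of_real p * \<alpha> + of_real q)) -
      (of_real b - of_real a * \<alpha>) * (\<beta> ^ n * (of_real p * \<beta> + of_real q))"
    unfolding ge2 by (simp add: algebra_simps)
  finally show ?case
    unfolding assms [symmetric] by (simp add: power2_eq_square mult_ac)
qed (simp_all add: algebra_simps)

text \<open>Coordinate \<open>k\<close> carries the power \<open>\<alpha> ^ (n + k)\<close>, which
  splits as \<open>\<alpha> ^ n * \<alpha> ^ k\<close>; the factors depending on \<open>k\<close>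
  assemble into \<open>power_octonion \<alpha>\<close>, and likewise for \<beta>.\<close>

lemma complexify_horadam_oct:
  fixes \<alpha> \<beta> :: complex
  assumes "\<alpha>\<^sup>2 = of_real p * \<alpha> + of_real q" and "\<beta>\<^sup>2 = of_real p * \<beta> + of_real q"
    and "\<alpha> \<noteq> \<beta>"
  shows "complexify (horadam_oct a b p q n) =
           ((of_real b - of_real a * \<beta>) / (\<alpha> - \<beta>) * \<alpha> ^ n) *\<^sub>O power_octonion \<alpha> -
           ((of_real b - of_real a * \<alpha>) / (\<alpha> - \<beta>) * \<beta> ^ n) *\<^sub>O power_octonion \<beta>"
proof -
  have "complex_of_real (horadam a b p q m) =
      (of_real b - of_real a * \<beta>) / (\<alpha> - \<beta>) * \<alpha> ^ m -
      (of_real b - of_real a * \<alpha>) / (\<alpha> - \<beta>) * \<beta> ^ m" for m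
    using horadam_binet[OF assms(1,2), of a b m] assms(3)
    by (simp add: diff_divide_distrib [symmetric] eq_divide_eq mult.commute)
  then show ?thesis
    unfolding horadam_oct_def power_octonion_def complexify_sum complexify_hom
    by (simp only: octonion.scale_sum_right sum_subtractf [symmetric] octonion.scale_scale
        octonion.scale_left_diff_distrib power_add mult.assoc)
qed

lemma sum_complexify_horadam_oct:
  fixes \<alpha> \<beta> :: complex
  assumes "\<alpha>\<^sup>2 = of_real p * \<alpha> + of_real q" and "\<beta>\<^sup>2 = of_real p * \<beta> + of_real q"
    and "\<alpha> \<noteq> \<beta>" and "\<alpha> \<noteq> 1" and "\<beta> \<noteq> 1"
    and "A = of_real b - of_real a * \<beta>" and "B = of_real b - of_real a * \<alpha>"
  shows "complexify (\<Sum>i = 0..n. horadam_oct a b p q i) =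
           (1 / (\<alpha> - \<beta>)) *\<^sub>O
             ((B * \<beta> ^ (n + 1) / (1 - \<beta>)) *\<^sub>O power_octonion \<beta> -
              (A * \<alpha> ^ (n + 1) / (1 - \<alpha>)) *\<^sub>O power_octonion \<alpha>) +
           (1 / ((\<alpha> - \<beta>) * (1 - \<alpha>) * (1 - \<beta>))) *\<^sub>O
             ((A * (1 - \<beta>)) *\<^sub>O power_octonion \<alpha> - (B * (1 - \<alpha>)) *\<^sub>O power_octonion \<beta>)"
    (is "_ = ?R")
proof -
  let ?u = "power_octonion \<alpha>" and ?v = "power_octonion \<beta>"
  have geometric: "(\<Sum>i = 0..n. z ^ i) = (1 - z ^ (n + 1)) / (1 - z)" if "z \<noteq> 1" for z :: complex
    using that by (simp add: sum_gp0 atLeast0AtMost)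
  have "complexify (\<Sum>i = 0..n. horadam_oct a b p q i) =
      (A / (\<alpha> - \<beta>) * (\<Sum>i = 0..n. \<alpha> ^ i)) *\<^sub>O ?u - (B / (\<alpha> - \<beta>) * (\<Sum>i = 0..n. \<beta> ^ i)) *\<^sub>O ?v"
    unfolding complexify_sum complexify_horadam_oct[OF assms(1-3)] assms(6,7)
    by (simp only: sum_distrib_left octonion.scale_sum_left sum_subtractf)
  \<comment> \<open>In the numerator \<open>1 - \<alpha> ^ (n + 1)\<close> the constant 1 yields the
    part independent of \<open>n\<close>, expanded by \<open>1 - \<beta>\<close> to reach the common
    denominator.\<close>
  also have "A / (\<alpha> - \<beta>) * (\<Sum>i = 0..n. \<alpha> ^ i) =
      1 / ((\<alpha> - \<beta>) * (1 - \<alpha>) * (1 - \<beta>)) * (A * (1 - \<beta>)) -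
      1 / (\<alpha> - \<beta>) * (A * \<alpha> ^ (n + 1) / (1 - \<alpha>))"
    using assms(3-5) unfolding geometric[OF assms(4)] by (simp add: divide_simps) (simp add: algebra_simps)
  also have "B / (\<alpha> - \<beta>) * (\<Sum>i = 0..n. \<beta> ^ i) =
      1 / ((\<alpha> - \<beta>) * (1 - \<alpha>) * (1 - \<beta>)) * (B * (1 - \<alpha>)) -
      1 / (\<alpha> - \<beta>) * (B * \<beta> ^ (n + 1) / (1 - \<beta>))"
    using assms(3-5) unfolding geometric[OF assms(5)] by (simp add: divide_simps) (simp add: algebra_simps)
  also have "(1 / ((\<alpha> - \<beta>) * (1 - \<alpha>) * (1 - \<beta>)) * (A * (1 - \<beta>)) -
      1 / (\<alpha> - \<beta>) * (A * \<alpha> ^ (n + 1) / (1 - \<alpha>))) *\<^sub>O ?u -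
      (1 / ((\<alpha> - \<beta>) * (1 - \<alpha>) * (1 - \<beta>)) * (B * (1 - \<alpha>)) -
      1 / (\<alpha> - \<beta>) * (B * \<beta> ^ (n + 1) / (1 - \<beta>))) *\<^sub>O ?v = ?R"
    by (simp only: octonion.scale_left_diff_distrib octonion.scale_right_diff_distrib
        octonion.scale_scale) (simp only: algebra_simps)
  finally show ?thesis .
qed

theorem theorem3p4:
  fixes a b p q :: real
    and \<alpha> \<beta> A B :: complex
    and K :: "complex octonion"
    and d1 d2 :: "real octonion"
    and n :: nat
  assumes "\<alpha> = (complex_of_real p + csqrt (complex_of_real (p\<^sup>2 + 4 * q))) / 2"
    and "\<beta> = (complex_of_real p - csqrt (complex_of_real (p\<^sup>2 + 4 * q))) / 2"
    and "\<alpha> \<noteq> \<beta>" and "\<alpha> \<noteq> 1" and "\<beta> \<noteq> 1"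
    and "A = complex_of_real b - complex_of_real a * \<beta>"
    and "B = complex_of_real b - complex_of_real a * \<alpha>"
    and "K = (1 / ((\<alpha> - \<beta>) * (1 - \<alpha>) * (1 - \<beta>))) *\<^sub>O
               ((A * (1 - \<beta>)) *\<^sub>O power_octonion \<alpha> - (B * (1 - \<alpha>)) *\<^sub>O power_octonion \<beta>)"
    and "d1 = (\<Sum>i = 0..n. horadam_oct a b p q i)"
    and "d2 = (\<Sum>i = 1..n + 1. horadam_oct a b p q i)"
  shows "(\<Sum>i = 0..n. dual_horadam_oct a b p q i) =
           (\<Sum>i = 0..n. dual_of_oct (horadam_oct a b p q i)) +
           (\<Sum>i = 1..n + 1. dual_of_oct (horadam_oct a b p q i) * \<epsilon>)
       \<and> (\<Sum>i = 0..n. dual_horadam_oct a b p q i) = Dual d1 d2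
       \<and> complexify d1 =
           (1 / (\<alpha> - \<beta>)) *\<^sub>O
             ((B * \<beta> ^ (n + 1) / (1 - \<beta>)) *\<^sub>O power_octonion \<beta> -
              (A * \<alpha> ^ (n + 1) / (1 - \<alpha>)) *\<^sub>O power_octonion \<alpha>) + K
       \<and> complexify d2 =
           (1 / (\<alpha> - \<beta>)) *\<^sub>O
             ((B * \<beta> ^ (n + 2) / (1 - \<beta>)) *\<^sub>O power_octonion \<beta> -
              (A * \<alpha> ^ (n + 2) / (1 - \<alpha>)) *\<^sub>O power_octonion \<alpha>)
           - complexify (horadam_oct a b p q 0) + K"
proof -
  \<comment> \<open>The complex square root squares to the discriminant whatever its sign, so real
    and non-real roots are treated alike.\<close>
  have "(csqrt (complex_of_real (p\<^sup>2 + 4 * q)))\<^sup>2 = of_real p ^ 2 + 4 * of_real q"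
    by simp
  then have roots: "\<alpha>\<^sup>2 = of_real p * \<alpha> + of_real q" "\<beta>\<^sup>2 = of_real p * \<beta> + of_real q"
    unfolding assms(1,2) by (simp_all add: field_simps power2_eq_square)
  note closed_form =
    sum_complexify_horadam_oct[OF roots assms(3-7), folded assms(8)]
  have d2_shift: "(\<Sum>i = 0..n. horadam_oct a b p q (i + 1)) = d2"
    unfolding assms(10) using sum.shift_bounds_cl_nat_ivl[of "horadam_oct a b p q" 0 1 n] by simp
  have sum_dual: "(\<Sum>i = 0..n. dual_horadam_oct a b p q i) = Dual d1 d2"
    unfolding dual_horadam_oct_def Dual_sum d2_shift assms(9) ..
  \<comment> \<open>Multiplication by \<epsilon> moves an octonion into the dual component, so the
    two sums fill separate components.\<close>
  have "dual_of_oct k * \<epsilon> = Dual 0 k" for k :: "real octonion"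
    by (simp add: dual_of_oct_def dual_eps_def times_dual_octonion_def)
  then have "Dual d1 d2 = (\<Sum>i = 0..n. dual_of_oct (horadam_oct a b p q i)) +
      (\<Sum>i = 1..n + 1. dual_of_oct (horadam_oct a b p q i) * \<epsilon>)"
    by (simp add: dual_of_oct_def Dual_sum plus_dual_octonion_def assms(9,10))
  \<comment> \<open>The removed term is the source of the summand with index 0; the upper limit
    \<open>n + 1\<close> gives the exponent \<open>n + 2\<close>, while \<open>K\<close> does not
    change with the limit.\<close>
  moreover have "d2 = (\<Sum>i = 0..n + 1. horadam_oct a b p q i) - horadam_oct a b p q 0"
    unfolding assms(10) by (simp add: sum.atLeast_Suc_atMost [of 0])
  then have "complexify d2 = (1 / (\<alpha> - \<beta>)) *\<^sub>O
      ((B * \<beta> ^ (n + 2) / (1 - \<beta>)) *\<^sub>O power_octonion \<beta> -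
       (A * \<alpha> ^ (n + 2) / (1 - \<alpha>)) *\<^sub>O power_octonion \<alpha>)
      - complexify (horadam_oct a b p q 0) + K"
    using closed_form[of "n + 1"] by (simp add: complexify_hom(2))
  ultimately show ?thesis
    using sum_dual closed_form[of n] unfolding assms(9) by simp
qed

end
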